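(* Let $X$ be an Archimedean vector lattice with universal completion $X^u$, and let $(x_n)$ be a sequence in $X$. Then $(x_n)$ uo-converges to $0$ in $X$ if and only if $(x_n)$ converges in order to $0$ in $X^u$. Moreover, $(x_n)$ is uo-Cauchy in $X$ if and only if $(x_n)$ is order convergent in $X^u$ (to some element of $X^u$).
   Context: All vector lattices are real and Archimedean. The universal completion $X^u$ of $X$ is the unique (up to lattice isomorphism) vector lattice that is order complete and laterally complete (every set of pairwise disjoint positive vectors has a supremum) and contains $X$ as an order dense sublattice (for every $0<u\in X^u$ there is $x\in X$ with $0<x\le u$). A net (in particular, a sequence) $(x_\alpha)_{\alpha\in\Gamma}$ in a vector lattice $Z$ converges in order to $x\in Z$ ($x_\alpha\xrightarrow{\rm o}x$) if there is a net $(a_\gamma)_{\gamma\in\Lambda}$ in $Z$ (possibly over a different index set) with $a_\gamma\downarrow 0$ in $Z$ such that for every $\gamma\in\Lambda$ there is $\alpha_0\in\Gamma$ with $|x_\alpha-x|\le a_\gamma$ for all $\alpha\ge\alpha_0$. It uo-converges to $x$ in $Z$ if $|x_\alpha-x|\wedge z\xrightarrow{\rm o}0$ in $Z$ for every $z\in Z_+$. A sequence $(x_n)$ is uo-Cauchy if the double net $(x_n-x_m)_{(n,m)}$, indexed by $\mathbb N\times\mathbb N$ with the product order, uo-converges to $0$. *)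

theory Defs
  imports Complex_Main "HOL-Library.Lattice_Algebras" "HOL-Library.Product_Order"
    "HOL-Library.Lub_Glb"
begin

class archimedean_vector_lattice = ordered_real_vector + lattice_ab_group_add_abs +
  assumes archimedean: "0 \<le> x \<Longrightarrow> (\<And>n::nat. real n *\<^sub>R x \<le> y) \<Longrightarrow> x = 0"

text \<open>Index types of nets. On products, the order of \<^theory>\<open>HOL-Library.Product_Order\<close>
  is the componentwise one.\<close>

class directed_preorder = preorder +
  assumes directed: "\<exists>k. i \<le> k \<and> j \<le> k"

instance nat :: directed_preorder
  by standard (metis nat_le_linear order_refl)

instance prod :: (directed_preorder, directed_preorder) directed_preorder
proof
  fix i j :: "'a \<times> 'b"
  obtain k l where "fst i \<le> k" "fst j \<le> k" "snd i \<le> l" "snd j \<le> l"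
    using directed by metis
  then show "\<exists>m. i \<le> m \<and> j \<le> m"
    by (intro exI[of _ "(k, l)"]) (auto simp: less_eq_prod_def)
qed

definition directed_set :: "'i set \<Rightarrow> ('i \<Rightarrow> 'i \<Rightarrow> bool) \<Rightarrow> bool" where
  "directed_set I le \<longleftrightarrow> I \<noteq> {}
     \<and> (\<forall>i\<in>I. le i i)
     \<and> (\<forall>i\<in>I. \<forall>j\<in>I. \<forall>k\<in>I. le i j \<longrightarrow> le j k \<longrightarrow> le i k)
     \<and> (\<forall>i\<in>I. \<forall>j\<in>I. \<exists>k\<in>I. le i k \<and> le j k)"

definition net_decreases_to_zero ::
    "'i set \<Rightarrow> ('i \<Rightarrow> 'i \<Rightarrow> bool) \<Rightarrow> ('i \<Rightarrow> 'a::archimedean_vector_lattice) \<Rightarrow> bool" where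
  "net_decreases_to_zero I le a \<longleftrightarrow> directed_set I le
     \<and> (\<forall>i\<in>I. \<forall>j\<in>I. le i j \<longrightarrow> a j \<le> a i)
     \<and> isGlb UNIV (a ` I) 0"

text \<open>HOL cannot quantify existentially over the index type of the dominating net. Taking
  index sets inside the vector lattice itself loses nothing, since only the range of that net
  matters; see \<open>order_convergesI\<close>.\<close>

definition order_converges ::
    "('i::directed_preorder \<Rightarrow> 'a::archimedean_vector_lattice) \<Rightarrow> 'a \<Rightarrow> bool" where
  "order_converges x l \<longleftrightarrow>
     (\<exists>(I::'a set) le (a::'a \<Rightarrow> 'a). net_decreases_to_zero I le a
        \<and> (\<forall>i\<in>I. \<exists>m. \<forall>n\<ge>m. \<bar>x n - l\<bar> \<le> a i))"

lemma order_convergesI: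
  fixes x :: "'i::directed_preorder \<Rightarrow> 'a::archimedean_vector_lattice"
    and I :: "'j set" and a :: "'j \<Rightarrow> 'a"
  assumes a: "net_decreases_to_zero I le a"
    and dom: "\<And>i. i \<in> I \<Longrightarrow> \<exists>m. \<forall>n\<ge>m. \<bar>x n - l\<bar> \<le> a i"
  shows "order_converges x l"
proof -
  have "directed_set (a ` I) (\<lambda>u v. v \<le> u)"
    unfolding directed_set_def
  proof (intro conjI ballI impI)
    show "a ` I \<noteq> {}"
      using a by (auto simp: net_decreases_to_zero_def directed_set_def)
    fix u v assume "u \<in> a ` I" "v \<in> a ` I"
    then obtain i j where ij: "i \<in> I" "j \<in> I" "u = a i" "v = a j" by blast
    then obtain k where "k \<in> I" "le i k" "le j k"
      using a unfolding net_decreases_to_zero_def directed_set_def by blast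
    then have "a k \<in> a ` I" "a k \<le> u" "a k \<le> v"
      using a ij unfolding net_decreases_to_zero_def by blast+
    then show "\<exists>w\<in>a ` I. w \<le> u \<and> w \<le> v" by blast
  qed auto
  then have "net_decreases_to_zero (a ` I) (\<lambda>u v. v \<le> u) (\<lambda>u. u)"
    using a by (simp add: net_decreases_to_zero_def)
  moreover have "\<forall>u\<in>a ` I. \<exists>m. \<forall>n\<ge>m. \<bar>x n - l\<bar> \<le> u"
    using dom by blast
  ultimately show ?thesis
    unfolding order_converges_def by blast
qed

definition uo_converges ::
    "('i::directed_preorder \<Rightarrow> 'a::archimedean_vector_lattice) \<Rightarrow> 'a \<Rightarrow> bool" where
  "uo_converges x l \<longleftrightarrow> (\<forall>z\<ge>0. order_converges (\<lambda>n. inf \<bar>x n - l\<bar> z) 0)"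

definition uo_Cauchy :: "(nat \<Rightarrow> 'a::archimedean_vector_lattice) \<Rightarrow> bool" where
  "uo_Cauchy x \<longleftrightarrow> uo_converges (\<lambda>(n, m). x n - x m) 0"

definition order_complete :: "'a::archimedean_vector_lattice itself \<Rightarrow> bool" where
  "order_complete _ \<longleftrightarrow>
     (\<forall>S::'a set. S \<noteq> {} \<longrightarrow> (\<exists>b. isUb UNIV S b) \<longrightarrow> (\<exists>s. isLub UNIV S s))"

text \<open>The empty set has to be excluded: its supremum would be a least element, which exists
  only in the zero lattice.\<close>

definition laterally_complete :: "'a::archimedean_vector_lattice itself \<Rightarrow> bool" where
  "laterally_complete _ \<longleftrightarrow>
     (\<forall>D::'a set. D \<noteq> {} \<longrightarrow> (\<forall>u\<in>D. 0 \<le> u)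
        \<longrightarrow> (\<forall>u\<in>D. \<forall>v\<in>D. u \<noteq> v \<longrightarrow> inf u v = 0) \<longrightarrow> (\<exists>s. isLub UNIV D s))"

definition lattice_embedding ::
    "('a::archimedean_vector_lattice \<Rightarrow> 'b::archimedean_vector_lattice) \<Rightarrow> bool" where
  "lattice_embedding \<iota> \<longleftrightarrow> linear \<iota> \<and> inj \<iota>
     \<and> (\<forall>x y. \<iota> (inf x y) = inf (\<iota> x) (\<iota> y))
     \<and> (\<forall>x y. \<iota> (sup x y) = sup (\<iota> x) (\<iota> y))"

text \<open>\<open>'b\<close> is the universal completion of \<open>'a\<close>, the inclusion being \<open>\<iota>\<close>.\<close>

definition universal_completion ::
    "('a::archimedean_vector_lattice \<Rightarrow> 'b::archimedean_vector_lattice) \<Rightarrow> bool" where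
  "universal_completion \<iota> \<longleftrightarrow> lattice_embedding \<iota>
     \<and> (\<forall>u>0. \<exists>x. 0 < \<iota> x \<and> \<iota> x \<le> u)
     \<and> order_complete TYPE('b) \<and> laterally_complete TYPE('b)"

end

theory Submission
  imports Defs
begin

text \<open>Call a net \<open>f \<ge> 0\<close> locally vanishing if every \<open>z > 0\<close> admits \<open>w > 0\<close> with
  \<open>w \<le> (z - f n)\<^sup>+\<close> eventually. Only elements, not infima, occur in this condition, so it passes
  freely between \<open>X\<close> and a vector lattice in which \<open>X\<close> is order dense. It characterizes
  uo-convergence to \<open>0\<close>, and, for order bounded nets, order convergence to \<open>0\<close>. What remains is to
  show that a sequence that is locally within \<open>z\<close> of a fixed element is order bounded in a
  universally complete vector lattice: on the band of such a \<open>w\<close> the sequence has an upper bound,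
  and the bounds on a maximal disjoint family of bands are glued by lateral completeness.\<close>

section \<open>Distributivity and disjointness in lattice-ordered groups\<close>

text \<open>By \<open>a + d = inf a d + sup a d\<close>, upper bounds on \<open>inf a d\<close> and
  \<open>sup a d\<close> bound \<open>d\<close>. This gives one bound for both \<open>b\<close> and
  \<open>c\<close>, hence for \<open>sup b c\<close>; the same identity for \<open>sup b c\<close>
  then cancels \<open>?s\<close>.\<close>

lemma inf_sup_le_distrib:
  fixes a b c :: "'a::lattice_ab_group_add"
  shows "inf a (sup b c) \<le> sup (inf a b) (inf a c)"
proof -
  let ?r = "sup (inf a b) (inf a c)" and ?s = "sup a (sup b c)"
  have "d \<le> ?s + ?r - a" if "inf a d \<le> ?r" "sup a d \<le> ?s" for d
    using add_mono[OF that(2,1)] add_eq_inf_sup[of a d] by (simp add: algebra_simps)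
  then have "sup b c \<le> ?s + ?r - a"
    by (simp add: le_supI1 le_supI2)
  then show ?thesis
    using add_eq_inf_sup[of a "sup b c"] by (simp add: algebra_simps)
qed

text \<open>Distributivity, used once in each argument, reduces the meet to meets involving
  \<open>p\<close>, \<open>q\<close> and \<open>0\<close>, all of which lie below
  \<open>0\<close>.\<close>

lemma inf_pos_parts_eq_0:
  fixes p q :: "'a::lattice_ab_group_add"
  assumes "inf p q \<le> 0"
  shows "inf (sup p 0) (sup q 0) = 0"
proof (rule order.antisym)
  have "inf (sup p 0) q \<le> sup (inf q p) (inf q 0)"
    using inf_sup_le_distrib[of q p 0] by (simp add: inf.commute)
  also have "\<dots> \<le> 0"
    using assms by (simp add: inf.commute)
  finally have "sup (inf (sup p 0) q) (inf (sup p 0) 0) \<le> 0"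
    by simp
  then show "inf (sup p 0) (sup q 0) \<le> 0"
    using inf_sup_le_distrib[of "sup p 0" q 0] by (rule order_trans[rotated])
qed simp

text \<open>The two terms are \<open>sup f z - z\<close> and \<open>sup f z - f\<close>; taking
  \<open>sup f z\<close> out of the meet leaves \<open>sup f z - sup f z\<close>.\<close>

lemma inf_pos_part_neg_part_eq_0:
  fixes f z :: "'a::lattice_ab_group_add"
  shows "inf (sup (f - z) 0) (sup (z - f) 0) = 0"
proof -
  have 1: "sup (f - z) 0 = sup f z + - z"
    using add_sup_distrib_right[of f z "- z"] by simp
  have 2: "sup (z - f) 0 = sup f z + - f"
    using add_sup_distrib_right[of f z "- f"] by (simp add: sup.commute)
  show ?thesis
    unfolding 1 2 add_inf_distrib_left[symmetric]
    by (simp add: neg_sup_eq_inf[symmetric] inf.commute del: neg_sup_eq_inf)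
qed

lemma inf_add_le:
  fixes a b c :: "'a::lattice_ab_group_add"
  assumes "0 \<le> a"
  shows "inf (a + b) c \<le> a + inf b c"
  using assms by (simp add: add_inf_distrib_left add_increasing le_infI2)

text \<open>Inductively, the meet of \<open>u\<close> with the next multiple is at most
  \<open>v + 0\<close> and at most \<open>u\<close>, so it lies below
  \<open>inf u v\<close>.\<close>

lemma inf_scaleR_eq_0:
  fixes u v :: "'a::archimedean_vector_lattice"
  assumes "0 \<le> u" "0 \<le> v" "inf u v = 0"
  shows "inf u (real k *\<^sub>R v) = 0"
proof (induction k)
  case 0
  then show ?case using assms by (simp add: inf_absorb2)
next
  case (Suc k)
  let ?t = "inf u (v + real k *\<^sub>R v)"
  have "?t \<le> v + inf u (real k *\<^sub>R v)"
    using inf_add_le[OF assms(2), of "real k *\<^sub>R v" u] by (simp add: inf.commute)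
  then have "?t \<le> inf u v"
    using Suc by simp
  moreover have "0 \<le> ?t"
    using assms by (simp add: scaleR_nonneg_nonneg)
  ultimately have "?t = 0"
    using assms(3) by simp
  then show ?case
    by (simp add: algebra_simps)
qed

text \<open>Each \<open>t\<close> in \<open>S\<close> is disjoint from \<open>p = inf s e\<close>,
  so \<open>t + p = sup t p \<le> s\<close>. Thus \<open>s - p\<close> is an upper bound of
  \<open>S\<close>, which forces \<open>s \<le> s - p\<close> and \<open>p \<le> 0\<close>.\<close>

lemma inf_isLub_eq_0:
  fixes s e :: "'a::archimedean_vector_lattice"
  assumes "isLub UNIV S s" "\<And>t. t \<in> S \<Longrightarrow> 0 \<le> t" "S \<noteq> {}" "0 \<le> e"
    and disj: "\<And>t. t \<in> S \<Longrightarrow> inf t e = 0"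
  shows "inf s e = 0"
proof -
  have s: "t \<le> s" if "t \<in> S" for t
    using isLubD2[OF assms(1) that] .
  then have s0: "0 \<le> s"
    using assms(2,3) by (meson all_not_in_conv order_trans)
  have "t \<le> s - inf s e" if "t \<in> S" for t
  proof -
    have "inf t (inf s e) = 0"
      using disj[OF that] s0 by (metis inf.absorb_iff2 inf.left_commute)
    then have "t + inf s e = sup t (inf s e)"
      using add_eq_inf_sup[of t "inf s e"] by simp
    also have "\<dots> \<le> s"
      using s[OF that] by simp
    finally show ?thesis
      by (simp add: le_diff_eq del: diff_inf_eq_sup)
  qed
  then have "s \<le> s - inf s e"
    using isLub_le_isUb[OF assms(1)] isUb_UNIV_I by blast
  then have "inf s e \<le> 0"
    by (simp only: le_diff_eq add_le_same_cancel1)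
  then show ?thesis
    using s0 assms(4) by (simp add: order.antisym)
qed

section \<open>Local vanishing as a test for order convergence and uo-convergence\<close>

definition vanishes_locally ::
    "('i::directed_preorder \<Rightarrow> 'a::archimedean_vector_lattice) \<Rightarrow> bool" where
  "vanishes_locally f \<longleftrightarrow> (\<forall>z>0. \<exists>w>0. \<exists>m. \<forall>n\<ge>m. w \<le> sup (z - f n) 0)"

lemma vanishes_locallyE:
  assumes "vanishes_locally f" "0 < z"
  obtains w m where "0 < w" "\<And>n. n \<ge> m \<Longrightarrow> w \<le> sup (z - f n) 0"
  using assms unfolding vanishes_locally_def by blast

lemma vanishes_locally_mono:
  assumes f: "vanishes_locally f" and "\<And>n. g n \<le> f n"
  shows "vanishes_locally g"
proof -
  have "sup (z - f n) 0 \<le> sup (z - g n) 0" for z n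
    using assms(2) by (intro sup.mono diff_mono) auto
  then show ?thesis
    using f unfolding vanishes_locally_def by (meson order_trans)
qed

text \<open>A positive \<open>z\<close> is not a lower bound of the dominating net, so some
  \<open>a i\<close> fails to dominate \<open>z\<close>, and \<open>sup (z - a i) 0\<close> serves
  as \<open>w\<close>.\<close>

lemma order_converges_imp_vanishes_locally:
  assumes "order_converges f l"
  shows "vanishes_locally (\<lambda>n. \<bar>f n - l\<bar>)"
  unfolding vanishes_locally_def
proof (intro allI impI)
  fix z :: 'b assume "0 < z"
  obtain I :: "'b set" and le a where net: "net_decreases_to_zero I le a"
    and dom: "\<And>i. i \<in> I \<Longrightarrow> \<exists>m. \<forall>n\<ge>m. \<bar>f n - l\<bar> \<le> a i"
    using assms unfolding order_converges_def by blast
  have "isGlb UNIV (a ` I) 0"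
    using net by (simp add: net_decreases_to_zero_def)
  moreover have "\<not> z \<le> 0"
    using \<open>0 < z\<close> by (simp add: less_le_not_le)
  ultimately obtain i where i: "i \<in> I" "\<not> z \<le> a i"
    unfolding isGlb_def greatestP_def isLb_def setle_def setge_def by blast
  obtain m where m: "\<And>n. n \<ge> m \<Longrightarrow> \<bar>f n - l\<bar> \<le> a i"
    using dom i by blast
  have "sup (z - a i) 0 \<noteq> 0"
    using i(2) by (metis diff_le_0_iff_le sup.cobounded1)
  then have "0 < sup (z - a i) 0"
    by (simp add: order_less_le)
  moreover have "sup (z - a i) 0 \<le> sup (z - \<bar>f n - l\<bar>) 0" if "n \<ge> m" for n
    using m[OF that] by (intro sup.mono diff_mono) auto
  ultimately show "\<exists>w>0. \<exists>m. \<forall>n\<ge>m. w \<le> sup (z - \<bar>f n - l\<bar>) 0"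
    by blast
qed

text \<open>The set \<open>S\<close> of all eventual upper bounds, directed downwards, is the
  dominating net; the order bound \<open>b\<close> makes it nonempty. A lower bound of
  \<open>S\<close> with nonzero positive part would allow every eventual bound to be lowered by a
  fixed \<open>w > 0\<close>, against the Archimedean property.\<close>

lemma order_converges_if_vanishes_locally:
  fixes f :: "'i::directed_preorder \<Rightarrow> 'a::archimedean_vector_lattice"
  assumes f: "vanishes_locally (\<lambda>n. \<bar>f n - l\<bar>)" and b: "\<And>n. \<bar>f n - l\<bar> \<le> b"
  shows "order_converges f l"
proof -
  define S where "S = {c. \<exists>m. \<forall>n\<ge>m. \<bar>f n - l\<bar> \<le> c}"
  have pos: "0 \<le> c" if "c \<in> S" for c
    using that unfolding S_def by (auto intro: order_trans[OF abs_ge_zero])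
  have bS: "b \<in> S"
    using b by (simp add: S_def)
  have inf_S: "inf c d \<in> S" if cd: "c \<in> S" "d \<in> S" for c d
  proof -
    obtain p q where pq: "\<And>n. n \<ge> p \<Longrightarrow> \<bar>f n - l\<bar> \<le> c" "\<And>n. n \<ge> q \<Longrightarrow> \<bar>f n - l\<bar> \<le> d"
      using cd unfolding S_def by blast
    obtain m where "p \<le> m" "q \<le> m"
      using directed by blast
    then have "\<bar>f n - l\<bar> \<le> inf c d" if "n \<ge> m" for n
      using that pq order_trans by (metis le_inf_iff)
    then show ?thesis
      by (auto simp: S_def)
  qed
  have "v \<le> 0" if v: "\<And>c. c \<in> S \<Longrightarrow> v \<le> c" for v
  proof (rule ccontr)
    assume "\<not> v \<le> 0"
    then have "0 < sup v 0"
      by (metis order_less_le sup.cobounded1 sup.cobounded2)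
    then obtain w m where w: "0 < w" "\<And>n. n \<ge> m \<Longrightarrow> w \<le> sup (sup v 0 - \<bar>f n - l\<bar>) 0"
      using vanishes_locallyE[OF f] by blast
    \<comment> \<open>Adding \<open>\<bar>f n - l\<bar>\<close> to the inequality for
      \<open>w\<close> turns its right side into a join of \<open>v\<close>, \<open>0\<close> and
      \<open>\<bar>f n - l\<bar>\<close>, each of which is eventually at most
      \<open>c\<close>.\<close>
    have step: "c - w \<in> S" if c: "c \<in> S" for c
    proof -
      obtain p where p: "\<And>n. n \<ge> p \<Longrightarrow> \<bar>f n - l\<bar> \<le> c"
        using c unfolding S_def by blast
      obtain q where q: "p \<le> q" "m \<le> q"
        using directed by blast
      have "\<bar>f n - l\<bar> \<le> c - w" if "n \<ge> q" for n
      proof -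
        have "w + \<bar>f n - l\<bar> \<le> sup (sup v 0 - \<bar>f n - l\<bar>) 0 + \<bar>f n - l\<bar>"
          using w(2) that q by (simp add: order_trans[OF q(2) that])
        also have "\<dots> = sup (sup v 0) \<bar>f n - l\<bar>"
          by (simp add: add_sup_distrib_right)
        also have "\<dots> \<le> c"
          using v[OF c] pos[OF c] p order_trans[OF q(1) that] by simp
        finally show ?thesis
          by (simp add: algebra_simps)
      qed
      then show ?thesis
        unfolding S_def by blast
    qed
    have "b - real k *\<^sub>R w \<in> S" for k
    proof (induction k)
      case 0
      then show ?case using bS by simp
    next
      case (Suc k)
      then show ?case using step by (fastforce simp: algebra_simps)
    qed
    then have "real k *\<^sub>R w \<le> b" for k
      using pos by fastforce
    then have "w = 0"
      using w(1) archimedean by (metis order_less_imp_le)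
    then show False
      using w(1) by simp
  qed
  then have "isGlb UNIV S 0"
    using pos by (auto simp: isGlb_def greatestP_def isLb_def setle_def setge_def)
  moreover have "directed_set S (\<lambda>u v. v \<le> u)"
    unfolding directed_set_def using bS inf_S by (auto intro: inf_le1 inf_le2)
  ultimately have "net_decreases_to_zero S (\<lambda>u v. v \<le> u) (\<lambda>u. u)"
    by (simp add: net_decreases_to_zero_def)
  then show ?thesis
    by (rule order_convergesI) (auto simp: S_def)
qed

text \<open>Truncating at \<open>z\<close> does not affect the test against \<open>z\<close>,
  because \<open>z - inf g z = sup (z - g) 0\<close>. Conversely, every truncation is order bounded
  and inherits local vanishing.\<close>

lemma uo_converges_iff_vanishes_locally:
  fixes f :: "'i::directed_preorder \<Rightarrow> 'a::archimedean_vector_lattice"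
  shows "uo_converges f l \<longleftrightarrow> vanishes_locally (\<lambda>n. \<bar>f n - l\<bar>)"
proof
  assume f: "uo_converges f l"
  show "vanishes_locally (\<lambda>n. \<bar>f n - l\<bar>)"
    unfolding vanishes_locally_def
  proof (intro allI impI)
    fix z :: 'a assume z: "0 < z"
    then have *: "vanishes_locally (\<lambda>n. \<bar>inf \<bar>f n - l\<bar> z - 0\<bar>)"
      using f unfolding uo_converges_def
      by (intro order_converges_imp_vanishes_locally) auto
    have "sup (z - \<bar>inf \<bar>f n - l\<bar> z - 0\<bar>) 0 = sup (z - \<bar>f n - l\<bar>) 0" for n
    proof -
      have "\<bar>inf \<bar>f n - l\<bar> z - 0\<bar> = inf \<bar>f n - l\<bar> z"
        using z by (simp add: order_less_imp_le)
      then show ?thesis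
        by (simp add: add_sup_distrib_left)
    qed
    then show "\<exists>w>0. \<exists>m. \<forall>n\<ge>m. w \<le> sup (z - \<bar>f n - l\<bar>) 0"
      using * z unfolding vanishes_locally_def by metis
  qed
next
  assume f: "vanishes_locally (\<lambda>n. \<bar>f n - l\<bar>)"
  show "uo_converges f l"
    unfolding uo_converges_def
  proof (intro allI impI)
    fix z :: 'a assume "0 \<le> z"
    then have eq: "\<bar>inf \<bar>f n - l\<bar> z - 0\<bar> = inf \<bar>f n - l\<bar> z" for n
      by simp
    show "order_converges (\<lambda>n. inf \<bar>f n - l\<bar> z) 0"
      by (rule order_converges_if_vanishes_locally[where b = z])
        (simp_all only: eq vanishes_locally_mono[OF f] inf_le1 inf_le2)
  qed
qed

text \<open>The two conditions are chained: the element \<open>v\<close> obtained from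
  \<open>f\<close> and \<open>z\<close> becomes the test element for \<open>g\<close>. Positivity of
  \<open>g\<close> lets \<open>(z - f n)\<close> have its positive part taken before
  \<open>g m\<close> is subtracted.\<close>

lemma vanishes_locally_add:
  fixes f :: "'i::directed_preorder \<Rightarrow> 'a::archimedean_vector_lattice"
    and g :: "'j::directed_preorder \<Rightarrow> 'a"
  assumes f: "vanishes_locally f" and g: "vanishes_locally g" and "\<And>m. 0 \<le> g m"
  shows "vanishes_locally (\<lambda>(n, m). f n + g m)"
  unfolding vanishes_locally_def
proof (intro allI impI)
  fix z :: 'a assume "0 < z"
  then obtain v p where v: "0 < v" "\<And>n. n \<ge> p \<Longrightarrow> v \<le> sup (z - f n) 0"
    using vanishes_locallyE[OF f] by blast
  then obtain w q where w: "0 < w" "\<And>n. n \<ge> q \<Longrightarrow> w \<le> sup (v - g n) 0"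
    using vanishes_locallyE[OF g] by blast
  have "w \<le> sup (z - (f n + g m)) 0" if "n \<ge> p" "m \<ge> q" for n m
  proof -
    have "v - g m \<le> sup (z - f n) 0 + - g m"
      using v(2)[OF that(1)] by simp
    also have "\<dots> = sup (z - (f n + g m)) (- g m)"
      by (simp only: add_sup_distrib_right) (simp add: algebra_simps)
    also have "\<dots> \<le> sup (z - (f n + g m)) 0"
      using assms(3) by (intro sup.mono) auto
    finally have "sup (v - g m) 0 \<le> sup (z - (f n + g m)) 0"
      by simp
    then show ?thesis
      using w(2)[OF that(2)] by (rule order_trans[rotated])
  qed
  then show "\<exists>w>0. \<exists>m. \<forall>n\<ge>m. w \<le> sup (z - (case n of (n, m) \<Rightarrow> f n + g m)) 0"
    using w(1) by (intro exI[of _ w] conjI exI[of _ "(p, q)"]) (auto simp: less_eq_prod_def)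
qed

section \<open>Transfer along an order dense embedding\<close>

lemma lattice_embedding_le_iff:
  assumes "lattice_embedding \<iota>"
  shows "\<iota> x \<le> \<iota> y \<longleftrightarrow> x \<le> y"
  using assms unfolding lattice_embedding_def le_iff_inf by (metis injD)

lemma lattice_embedding_pos_iff:
  assumes "lattice_embedding \<iota>"
  shows "0 < \<iota> x \<longleftrightarrow> 0 < x"
proof -
  have "\<iota> 0 = 0"
    using assms by (simp add: lattice_embedding_def linear_0)
  then show ?thesis
    using lattice_embedding_le_iff[OF assms, of 0 x] lattice_embedding_le_iff[OF assms, of x 0]
    by (simp add: less_le_not_le)
qed

lemma lattice_embedding_abs:
  assumes "lattice_embedding \<iota>"
  shows "\<iota> \<bar>x\<bar> = \<bar>\<iota> x\<bar>"
  using assms by (simp add: lattice_embedding_def abs_lattice linear_neg)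

text \<open>Order density is applied to the witness \<open>w\<close> when passing down to the
  sublattice, and to the test element \<open>z\<close> when passing up.\<close>

lemma vanishes_locally_embedding_iff:
  fixes \<iota> :: "'a::archimedean_vector_lattice \<Rightarrow> 'b::archimedean_vector_lattice"
    and f :: "'i::directed_preorder \<Rightarrow> 'a"
  assumes emb: "lattice_embedding \<iota>" and dense: "\<And>u. u > 0 \<Longrightarrow> \<exists>x. 0 < \<iota> x \<and> \<iota> x \<le> u"
  shows "vanishes_locally (\<lambda>n. \<iota> (f n)) \<longleftrightarrow> vanishes_locally f"
proof -
  note pos = lattice_embedding_pos_iff[OF emb] and le = lattice_embedding_le_iff[OF emb]
  have eq: "sup (\<iota> z - \<iota> (f n)) 0 = \<iota> (sup (z - f n) 0)" for z n
    using emb by (simp add: lattice_embedding_def linear_diff linear_0)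
  show ?thesis
  proof
    assume L: "vanishes_locally (\<lambda>n. \<iota> (f n))"
    show "vanishes_locally f"
      unfolding vanishes_locally_def
    proof (intro allI impI)
      fix z :: 'a assume "0 < z"
      then have "0 < \<iota> z" by (simp add: pos)
      with L obtain w m where w: "0 < w" "\<And>n. n \<ge> m \<Longrightarrow> w \<le> sup (\<iota> z - \<iota> (f n)) 0"
        by (metis vanishes_locallyE)
      obtain u where u: "0 < \<iota> u" "\<iota> u \<le> w"
        using dense w(1) by blast
      have "u \<le> sup (z - f n) 0" if "n \<ge> m" for n
        using order_trans[OF u(2) w(2)[OF that]] by (simp only: eq le)
      then show "\<exists>w>0. \<exists>m. \<forall>n\<ge>m. w \<le> sup (z - f n) 0"
        using u(1) pos by blast
    qed
  next
    assume R: "vanishes_locally f"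
    show "vanishes_locally (\<lambda>n. \<iota> (f n))"
      unfolding vanishes_locally_def
    proof (intro allI impI)
      fix z :: 'b assume "0 < z"
      then obtain u where u: "0 < \<iota> u" "\<iota> u \<le> z"
        using dense by blast
      then have "0 < u" by (simp add: pos)
      with R obtain w m where w: "0 < w" "\<And>n. n \<ge> m \<Longrightarrow> w \<le> sup (u - f n) 0"
        by (metis vanishes_locallyE)
      have "\<iota> w \<le> sup (z - \<iota> (f n)) 0" if "n \<ge> m" for n
      proof -
        have "\<iota> w \<le> sup (\<iota> u - \<iota> (f n)) 0"
          using w(2)[OF that] by (simp only: eq le)
        also have "\<dots> \<le> sup (z - \<iota> (f n)) 0"
          using u(2) by (intro sup.mono diff_mono) auto
        finally show ?thesis .
      qed
      then show "\<exists>w>0. \<exists>m. \<forall>n\<ge>m. w \<le> sup (z - \<iota> (f n)) 0"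
        using w(1) pos by blast
    qed
  qed
qed

section \<open>Gluing local bounds in a universally complete vector lattice\<close>

text \<open>For \<open>a \<ge> 0\<close>, the supremum over \<open>k\<close> of
  \<open>inf a (real k *\<^sub>R w)\<close> is the projection of \<open>a\<close> onto the band
  generated by \<open>w\<close>. So \<open>loc\<close> says that below every \<open>z > 0\<close>
  there is a band generator on whose band \<open>A\<close> is bounded. Bounds on a maximal disjoint
  family of such bands are made disjoint and joined to \<open>b\<close>; if \<open>b\<close> failed
  for some \<open>a\<close>, the positive part of \<open>a - b\<close> would yield a further member
  of the family.\<close>

lemma bounded_if_locally_bounded:
  fixes A :: "'a::archimedean_vector_lattice set"
  assumes oc: "order_complete TYPE('a)" and lc: "laterally_complete TYPE('a)"
    and A: "\<And>a. a \<in> A \<Longrightarrow> 0 \<le> a"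
    and loc: "\<And>z::'a. 0 < z \<Longrightarrow>
      \<exists>w c. 0 < w \<and> w \<le> z \<and> 0 \<le> c \<and> (\<forall>a\<in>A. \<forall>k. inf a (real k *\<^sub>R w) \<le> c)"
  shows "\<exists>b. \<forall>a\<in>A. a \<le> b"
proof -
  define G where "G = {w. 0 < w \<and> (\<exists>c\<ge>0. \<forall>a\<in>A. \<forall>k. inf a (real k *\<^sub>R w) \<le> c)}"
  define \<F> where "\<F> = {D. D \<subseteq> G \<and> (\<forall>u\<in>D. \<forall>v\<in>D. u \<noteq> v \<longrightarrow> inf u v = 0)}"
  have "\<exists>D\<in>\<F>. \<forall>E\<in>\<F>. D \<subseteq> E \<longrightarrow> E = D"
  proof (rule subset_Zorn')
    fix \<C> assume chain: "subset.chain \<F> \<C>"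
    have "\<Union>\<C> \<subseteq> G"
      using chain unfolding subset.chain_def \<F>_def by blast
    moreover have "inf u v = 0" if uv: "u \<in> \<Union>\<C>" "v \<in> \<Union>\<C>" "u \<noteq> v" for u v
    proof -
      obtain D E where DE: "D \<in> \<C>" "E \<in> \<C>" "u \<in> D" "v \<in> E"
        using uv by blast
      then consider "D \<subseteq> E" | "E \<subseteq> D"
        using chain unfolding subset.chain_def by blast
      then obtain H where "H \<in> \<C>" "u \<in> H" "v \<in> H"
        using DE by cases auto
      then show ?thesis
        using chain uv(3) unfolding subset.chain_def \<F>_def by blast
    qed
    ultimately show "\<Union>\<C> \<in> \<F>"
      unfolding \<F>_def by blast
  qed
  then obtain D where D: "D \<in> \<F>" and D_max: "\<And>E. E \<in> \<F> \<Longrightarrow> D \<subseteq> E \<Longrightarrow> E = D"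
    by blast
  have D_pos: "0 < d" if "d \<in> D" for d
    using that D unfolding \<F>_def G_def by blast
  have D_disj: "inf d e = 0" if "d \<in> D" "e \<in> D" "d \<noteq> e" for d e
    using that D unfolding \<F>_def by blast
  have "\<exists>s\<ge>0. (\<forall>a\<in>A. \<forall>k. inf a (real k *\<^sub>R d) \<le> s)
      \<and> (\<forall>e\<ge>0. inf d e = 0 \<longrightarrow> inf s e = 0)" if d: "d \<in> D" for d
  proof -
    have d0: "0 \<le> d"
      using D_pos[OF d] by simp
    then have kd0: "0 \<le> real k *\<^sub>R d" for k
      by (simp add: scaleR_nonneg_nonneg)
    obtain c where c: "0 \<le> c" "\<And>a k. a \<in> A \<Longrightarrow> inf a (real k *\<^sub>R d) \<le> c"
      using d D unfolding \<F>_def G_def by blast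
    \<comment> \<open>The supremum of \<open>?S\<close> is the projection of \<open>c\<close> onto
      the band of \<open>d\<close>. It bounds the same truncations as \<open>c\<close>, and in
      addition is disjoint from whatever is disjoint from \<open>d\<close>.\<close>
    let ?S = "range (\<lambda>k. inf c (real k *\<^sub>R d))"
    have "isUb UNIV ?S c"
      by (rule isUb_UNIV_I) auto
    then obtain s where s: "isLub UNIV ?S s"
      using oc unfolding order_complete_def by (metis UNIV_not_empty image_is_empty)
    have le_s: "inf c (real k *\<^sub>R d) \<le> s" for k
      using isLubD2[OF s] by blast
    have "0 \<le> inf c (real 0 *\<^sub>R d)"
      using c(1) by simp
    then have "0 \<le> s"
      using le_s order_trans by blast
    moreover have "inf a (real k *\<^sub>R d) \<le> s" if "a \<in> A" for a k
      using le_s[of k] c(2)[OF that, of k] by (meson inf.cobounded2 le_inf_iff order_trans)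
    moreover have "inf s e = 0" if e: "0 \<le> e" "inf d e = 0" for e
    proof (rule inf_isLub_eq_0[OF s])
      fix t assume "t \<in> ?S"
      then obtain k where k: "t = inf c (real k *\<^sub>R d)"
        by blast
      show t0: "0 \<le> t"
        using c(1) kd0 k by simp
      have "inf t e \<le> inf e (real k *\<^sub>R d)"
        unfolding k by (simp add: inf.coboundedI1)
      also have "\<dots> = 0"
        using inf_scaleR_eq_0 e d0 by (metis inf.commute)
      finally show "inf t e = 0"
        using t0 e(1) by (simp add: order.antisym)
    qed (use e in auto)
    ultimately show ?thesis
      by blast
  qed
  then obtain s where s0: "\<And>d. d \<in> D \<Longrightarrow> 0 \<le> s d"
    and s_bd: "\<And>d a k. d \<in> D \<Longrightarrow> a \<in> A \<Longrightarrow> inf a (real k *\<^sub>R d) \<le> s d"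
    and s_disj: "\<And>d e. d \<in> D \<Longrightarrow> 0 \<le> e \<Longrightarrow> inf d e = 0 \<Longrightarrow> inf (s d) e = 0"
    by metis
  \<comment> \<open>Disjointness is carried over one argument at a time, through
    \<open>inf (s d) e = 0\<close>.\<close>
  have s_disj': "inf (s d) (s e) = 0" if "d \<in> D" "e \<in> D" "d \<noteq> e" for d e
  proof -
    have "inf (s d) e = 0"
      using that D_disj s_disj D_pos by (metis order_less_imp_le)
    then show ?thesis
      using that s_disj s0 by (metis inf.commute)
  qed
  \<comment> \<open>Inserting \<open>0\<close> keeps the family nonempty when \<open>D\<close> is
    empty and gives \<open>0 \<le> b\<close>.\<close>
  let ?T = "insert 0 (s ` D)"
  have "inf u v = 0" if "u \<in> ?T" "v \<in> ?T" "u \<noteq> v" for u v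
    using that s_disj' s0 by (auto simp: inf_absorb1 inf_absorb2)
  moreover have "\<forall>u\<in>?T. 0 \<le> u"
    using s0 by auto
  ultimately obtain b where b: "isLub UNIV ?T b"
    using lc unfolding laterally_complete_def by (metis insert_not_empty)
  have sb: "s d \<le> b" if "d \<in> D" for d
    using isLubD2[OF b] that by auto
  have b0: "0 \<le> b"
    using isLubD2[OF b] by auto
  have "a \<le> b" if a: "a \<in> A" for a
  proof (rule ccontr)
    assume "\<not> a \<le> b"
    define r where "r = sup (a - b) 0"
    have "r \<noteq> 0"
      using \<open>\<not> a \<le> b\<close> unfolding r_def by (metis diff_le_0_iff_le sup.cobounded1)
    then have r: "0 < r"
      by (simp add: r_def order_less_le)
    \<comment> \<open>On the band of \<open>d\<close> the element \<open>b\<close> already dominates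
      \<open>a\<close>, so the excess \<open>r\<close> should vanish there. This is shown by
      bounding all multiples of \<open>inf r d\<close> by \<open>b\<close>.\<close>
    have rd: "inf r d = 0" if d: "d \<in> D" for d
    proof -
      define t where "t = inf r d"
      have t: "0 \<le> t" "t \<le> r" "t \<le> d"
        using r D_pos[OF d] by (auto simp: t_def)
      have "real k *\<^sub>R t \<le> b" for k
      proof -
        \<comment> \<open>The excess \<open>?q\<close> lies below the positive part of
          \<open>real k *\<^sub>R d - b\<close>, which is disjoint from \<open>r\<close>. Hence
          \<open>?q\<close> is disjoint from \<open>t\<close> and from its multiple
          \<open>real k *\<^sub>R t\<close>; but it also lies below that multiple, so it is
          zero.\<close>
        let ?q = "sup (real k *\<^sub>R t - b) 0"
        have "inf (a - b) (real k *\<^sub>R d - b) = inf a (real k *\<^sub>R d) - b"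
          using add_inf_distrib_right[of a "real k *\<^sub>R d" "- b"] by simp
        also have "\<dots> \<le> 0"
          using order_trans[OF s_bd[OF d a] sb[OF d]] by simp
        finally have *: "inf r (sup (real k *\<^sub>R d - b) 0) = 0"
          unfolding r_def by (rule inf_pos_parts_eq_0)
        have "?q \<le> sup (real k *\<^sub>R d - b) 0"
          using t(3) by (intro sup.mono diff_mono scaleR_left_mono) auto
        then have "inf t ?q \<le> 0"
          using * t(2) by (metis inf_mono)
        then have "inf ?q t = 0"
          using t(1) by (simp add: order.antisym inf.commute)
        then have "inf ?q (real k *\<^sub>R t) = 0"
          using t(1) by (intro inf_scaleR_eq_0) auto
        moreover have "?q \<le> real k *\<^sub>R t"
          using t(1) b0 by (simp add: scaleR_nonneg_nonneg)
        ultimately have "?q = 0"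
          by (simp add: inf_absorb1)
        then show ?thesis
          by (metis diff_le_0_iff_le sup.cobounded1)
      qed
      then show ?thesis
        using archimedean[OF t(1)] unfolding t_def by blast
    qed
    \<comment> \<open>Being below \<open>r\<close>, this \<open>w\<close> is disjoint from all of
      \<open>D\<close>; maximality puts it into \<open>D\<close>, so it would be disjoint from
      itself.\<close>
    obtain w c where w: "0 < w" "w \<le> r" and c: "0 \<le> c" "\<forall>a\<in>A. \<forall>k. inf a (real k *\<^sub>R w) \<le> c"
      using loc[OF r] by blast
    have wd: "inf w d = 0" if "d \<in> D" for d
    proof (rule order.antisym)
      show "inf w d \<le> 0"
        using rd[OF that] w(2) by (metis inf_mono order_refl)
      show "0 \<le> inf w d"
        using w(1) D_pos[OF that] by (simp add: order_less_imp_le)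
    qed
    have "w \<in> G"
      using w(1) c by (auto simp: G_def)
    then have "insert w D \<in> \<F>"
      using D wd unfolding \<F>_def by (auto simp: inf.commute)
    then have "w \<in> D"
      using D_max by blast
    then show False
      using wd[of w] w(1) by simp
  qed
  then show ?thesis
    by blast
qed

text \<open>From \<open>m\<close> on, the part of \<open>\<bar>h n - e\<bar>\<close> exceeding
  \<open>z\<close> is disjoint from \<open>w\<close>, so on the band of \<open>w\<close> the tail is
  bounded by \<open>\<bar>e\<bar> + z\<close>. Only finitely many terms precede \<open>m\<close>,
  and their sum covers them.\<close>

lemma bounded_if_locally_eventually_bounded:
  fixes h :: "nat \<Rightarrow> 'a::archimedean_vector_lattice"
  assumes oc: "order_complete TYPE('a)" and lc: "laterally_complete TYPE('a)"
    and loc: "\<And>z::'a. 0 < z \<Longrightarrow> \<exists>w>0. \<exists>e m. \<forall>n\<ge>m. w \<le> sup (z - \<bar>h n - e\<bar>) 0"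
  shows "\<exists>b. \<forall>n. \<bar>h n\<bar> \<le> b"
proof -
  have "\<exists>w c. 0 < w \<and> w \<le> z \<and> 0 \<le> c \<and> (\<forall>a\<in>range (\<lambda>n. \<bar>h n\<bar>). \<forall>k. inf a (real k *\<^sub>R w) \<le> c)"
    if z: "0 < z" for z :: 'a
  proof -
    obtain w e m where w: "0 < w" "\<And>n. n \<ge> m \<Longrightarrow> w \<le> sup (z - \<bar>h n - e\<bar>) 0"
      using loc[OF z] by blast
    define c where "c = \<bar>e\<bar> + z + (\<Sum>n<m. \<bar>h n\<bar>)"
    have sum0: "0 \<le> (\<Sum>n<m. \<bar>h n\<bar>)"
      by (simp add: sum_nonneg)
    have ez: "0 \<le> \<bar>e\<bar> + z"
      using z by (simp add: order_less_imp_le)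
    have "w \<le> z"
    proof -
      have "w \<le> sup (z - \<bar>h m - e\<bar>) 0"
        using w(2) by blast
      also have "\<dots> \<le> z"
        using z by (simp add: order_less_imp_le)
      finally show ?thesis .
    qed
    moreover have "inf \<bar>h n\<bar> (real k *\<^sub>R w) \<le> c" for n k
    proof (cases "n < m")
      case True
      then have "\<bar>h n\<bar> \<le> (\<Sum>n<m. \<bar>h n\<bar>)"
        using sum_mono2[of "{..<m}" "{n}" "\<lambda>n. \<bar>h n\<bar>"] by simp
      also have "\<dots> \<le> c"
        using ez by (simp add: c_def)
      finally show ?thesis
        by (rule le_infI1)
    next
      case False
      let ?f = "\<bar>h n - e\<bar>" and ?q = "sup (\<bar>h n - e\<bar> - z) 0"
      have "inf ?q w \<le> inf ?q (sup (z - ?f) 0)"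
        using w(2) False by (intro inf_mono) auto
      also have "\<dots> = 0"
        by (rule inf_pos_part_neg_part_eq_0)
      finally have "inf ?q w = 0"
        using w(1) by (intro order.antisym) auto
      then have q: "inf ?q (real k *\<^sub>R w) = 0"
        using w(1) by (intro inf_scaleR_eq_0) auto
      have "?f - z \<le> ?q"
        by simp
      moreover have "\<bar>h n\<bar> \<le> \<bar>e\<bar> + ?f"
        using abs_triangle_ineq[of e "h n - e"] by simp
      ultimately have "\<bar>h n\<bar> \<le> (\<bar>e\<bar> + z) + ?q"
        by (smt (verit, ccfv_threshold) add.assoc add_left_mono diff_le_eq add.commute order_trans)
      then have "inf \<bar>h n\<bar> (real k *\<^sub>R w) \<le> inf ((\<bar>e\<bar> + z) + ?q) (real k *\<^sub>R w)"
        by (intro inf_mono) auto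
      also have "\<dots> \<le> (\<bar>e\<bar> + z) + inf ?q (real k *\<^sub>R w)"
        by (rule inf_add_le[OF ez])
      also have "\<dots> \<le> c"
        using q sum0 by (simp add: c_def)
      finally show ?thesis .
    qed
    moreover have "0 \<le> c"
      using ez sum0 by (simp add: c_def)
    ultimately show ?thesis
      using w(1) by blast
  qed
  then have "\<exists>b. \<forall>a\<in>range (\<lambda>n. \<bar>h n\<bar>). a \<le> b"
    by (intro bounded_if_locally_bounded[OF oc lc]) auto
  then show ?thesis
    by auto
qed

section \<open>Order Cauchy sequences and the two equivalences\<close>

text \<open>The limit is the limit inferior, obtained as the supremum of the set \<open>L\<close> of
  eventual lower bounds. The net dominating the differences also dominates
  \<open>\<bar>h n - y\<bar>\<close>: \<open>h n - a i\<close> belongs to \<open>L\<close>, and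
  every member of \<open>L\<close> is at most \<open>h n + a i\<close>.\<close>

lemma order_Cauchy_imp_order_convergent:
  fixes h :: "nat \<Rightarrow> 'a::archimedean_vector_lattice"
  assumes oc: "order_complete TYPE('a)" and b: "\<And>n. \<bar>h n\<bar> \<le> b"
    and Cauchy: "order_converges (\<lambda>(n, m). h n - h m) 0"
  shows "\<exists>y. order_converges h y"
proof -
  obtain I :: "'a set" and le a where net: "net_decreases_to_zero I le a"
    and dom: "\<And>i. i \<in> I \<Longrightarrow> \<exists>p. \<forall>q\<ge>p. \<bar>(case q of (n, m) \<Rightarrow> h n - h m) - 0\<bar> \<le> a i"
    using Cauchy unfolding order_converges_def by blast
  define L where "L = {v. \<exists>N. \<forall>n\<ge>N. v \<le> h n}"
  have "- b \<in> L"
    using abs_le_D2[OF b] by (auto simp: L_def minus_le_iff)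
  moreover have "v \<le> b" if "v \<in> L" for v
    using that abs_le_D1[OF b] unfolding L_def by (blast intro: order_trans)
  ultimately obtain y where y: "isLub UNIV L y"
    using oc isUb_UNIV_I[of L b] unfolding order_complete_def by blast
  have "\<exists>m. \<forall>n\<ge>m. \<bar>h n - y\<bar> \<le> a i" if i: "i \<in> I" for i
  proof -
    obtain p q where pq: "\<And>n m. n \<ge> p \<Longrightarrow> m \<ge> q \<Longrightarrow> \<bar>h n - h m\<bar> \<le> a i"
      using dom[OF i] by (auto simp: less_eq_prod_def)
    have "\<bar>h n - y\<bar> \<le> a i" if n: "n \<ge> p" for n
    proof (rule abs_leI)
      have "h n - a i \<le> h m" if "m \<ge> q" for m
        using abs_le_D1[OF pq[OF n that]] by (simp add: algebra_simps)
      then have "h n - a i \<in> L"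
        unfolding L_def by blast
      then show "h n - y \<le> a i"
        using isLubD2[OF y] by (fastforce simp: algebra_simps)
      have "v \<le> h n + a i" if v: "v \<in> L" for v
      proof -
        obtain N where N: "\<And>m. m \<ge> N \<Longrightarrow> v \<le> h m"
          using v unfolding L_def by blast
        have "v \<le> h (max N q)"
          using N by simp
        also have "\<dots> \<le> h n + a i"
          using abs_le_D2[OF pq[OF n, of "max N q"]] by (simp add: algebra_simps)
        finally show ?thesis .
      qed
      then have "y \<le> h n + a i"
        by (intro isLub_le_isUb[OF y] isUb_UNIV_I)
      then show "- (h n - y) \<le> a i"
        by (simp add: algebra_simps)
    qed
    then show ?thesis
      by blast
  qed
  then show ?thesis
    using order_convergesI[OF net] by blast
qed

theorem corollary3p12:
  fixes \<iota> :: "'a::archimedean_vector_lattice \<Rightarrow> 'b::archimedean_vector_lattice"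
    and x :: "nat \<Rightarrow> 'a"
  assumes "universal_completion \<iota>"
  shows "(uo_converges x 0 \<longleftrightarrow> order_converges (\<lambda>n. \<iota> (x n)) 0)
       \<and> (uo_Cauchy x \<longleftrightarrow> (\<exists>y. order_converges (\<lambda>n. \<iota> (x n)) y))"
proof -
  let ?h = "\<lambda>n. \<iota> (x n)"
  have emb: "lattice_embedding \<iota>" and dense: "\<And>u. u > 0 \<Longrightarrow> \<exists>x. 0 < \<iota> x \<and> \<iota> x \<le> u"
    and oc: "order_complete TYPE('b)" and lc: "laterally_complete TYPE('b)"
    using assms by (auto simp: universal_completion_def)
  have diff: "\<iota> (u - v) = \<iota> u - \<iota> v" for u v
    using emb by (simp add: lattice_embedding_def linear_diff)
  have uo: "uo_converges x 0 \<longleftrightarrow> vanishes_locally (\<lambda>n. \<bar>?h n - 0\<bar>)"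
    unfolding uo_converges_iff_vanishes_locally
    using vanishes_locally_embedding_iff[OF emb dense, of "\<lambda>n. \<bar>x n\<bar>"]
    by (simp add: lattice_embedding_abs[OF emb])
  have uoC: "uo_Cauchy x \<longleftrightarrow> vanishes_locally (\<lambda>p. \<bar>(case p of (n, m) \<Rightarrow> ?h n - ?h m) - 0\<bar>)"
    unfolding uo_Cauchy_def uo_converges_iff_vanishes_locally
    using vanishes_locally_embedding_iff[OF emb dense, of "\<lambda>(n, m). \<bar>x n - x m\<bar>"]
    by (simp add: lattice_embedding_abs[OF emb] diff case_prod_unfold)
  have "order_converges ?h 0" if "uo_converges x 0"
  proof -
    have v: "vanishes_locally (\<lambda>n. \<bar>?h n - 0\<bar>)"
      using that uo by simp
    then have "\<exists>b. \<forall>n. \<bar>?h n\<bar> \<le> b"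
      by (intro bounded_if_locally_eventually_bounded[OF oc lc]) (meson vanishes_locally_def)
    then show ?thesis
      using order_converges_if_vanishes_locally[OF v] by auto
  qed
  moreover have "uo_converges x 0" if "order_converges ?h 0"
    using order_converges_imp_vanishes_locally[OF that] uo by simp
  moreover have "\<exists>y. order_converges ?h y" if "uo_Cauchy x"
  proof -
    have v: "vanishes_locally (\<lambda>p. \<bar>(case p of (n, m) \<Rightarrow> ?h n - ?h m) - 0\<bar>)"
      using that uoC by simp
    \<comment> \<open>Freezing the second index of the double net at \<open>snd p\<close> supplies
      the fixed element \<open>e\<close>, which may depend on \<open>z\<close>.\<close>
    have "\<exists>w>0. \<exists>e m. \<forall>n\<ge>m. w \<le> sup (z - \<bar>?h n - e\<bar>) 0" if z: "0 < z" for z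
    proof -
      obtain w p where "0 < w"
        and w: "\<And>q. q \<ge> p \<Longrightarrow> w \<le> sup (z - \<bar>(case q of (n, m) \<Rightarrow> ?h n - ?h m) - 0\<bar>) 0"
        using vanishes_locallyE[OF v z] by blast
      moreover have "w \<le> sup (z - \<bar>?h n - ?h (snd p)\<bar>) 0" if "n \<ge> fst p" for n
        using w[of "(n, snd p)"] that by (simp add: less_eq_prod_def)
      ultimately show ?thesis
        by blast
    qed
    then obtain b where b: "\<And>n. \<bar>?h n\<bar> \<le> b"
      using bounded_if_locally_eventually_bounded[OF oc lc, of ?h] by blast
    \<comment> \<open>An order bound on the double net upgrades its local vanishing to order
      convergence.\<close>
    have "\<bar>?h n - ?h m\<bar> \<le> b + b" for n m
      using abs_triangle_ineq4[of "?h n" "?h m"] add_mono[OF b b] by (rule order_trans)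
    then have "order_converges (\<lambda>(n, m). ?h n - ?h m) 0"
      by (intro order_converges_if_vanishes_locally[OF v, of "b + b"]) (auto split: prod.split)
    then show ?thesis
      using order_Cauchy_imp_order_convergent[where h = ?h, OF oc b] by blast
  qed
  moreover have "uo_Cauchy x" if "order_converges ?h y" for y
  proof -
    have v: "vanishes_locally (\<lambda>n. \<bar>?h n - y\<bar>)"
      using order_converges_imp_vanishes_locally[OF that] .
    \<comment> \<open>The right side, as a double net, vanishes locally because it adds two copies
      of the same locally vanishing sequence in independent indices.\<close>
    have "\<bar>?h n - ?h m\<bar> \<le> \<bar>?h n - y\<bar> + \<bar>?h m - y\<bar>" for n m
      using abs_triangle_ineq4[of "?h n - y" "?h m - y"] by simp
    then show ?thesis
      unfolding uoC
      by (intro vanishes_locally_mono[OF vanishes_locally_add[OF v v]]) auto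
  qed
  ultimately show ?thesis
    by blast
qed

end
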